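(* Let $F$ be an iterated function system on a complete metric space $M$ and let $S=S(F)$ be the semigroup generated by $F$. For every $U\in S$ the following conditions are equivalent: (1) $U$ is a constant map; (2) there is a map $V\in S$ satisfying $U\circ V=U$; (3) $U$ is idempotent, i.e. $U\circ U=U$; (4) $U$ is a dead-end in the Cayley graph $\Gamma(S)$, i.e. $U\circ f=U$ for all $f\in F$.
   Context: An iterated function system (IFS) $F$ is a nonempty finite set of contractions (Lipschitz maps with constant $<1$) of a nonempty complete metric space $M$ into itself. $S=S(F)$ is the subsemigroup, under composition, of the set of all self-maps of $M$ generated by $F$ (all finite nonempty compositions of elements of $F$). The Cayley graph $\Gamma(S)$ has vertex set $S$ and, for each $(s,f)\in S\times F$, an edge from $s$ to $s\circ f$; a dead-end is a vertex each of whose outgoing edges is a loop. *)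

theory Defs
  imports "HOL-Analysis.Analysis" "Graph_Theory.Digraph"
begin

text \<open>
  The nonempty complete metric space is the whole type \<open>'a :: complete_space\<close> (HOL types are
  nonempty), so its self-maps are exactly the functions of type \<open>'a \<Rightarrow> 'a\<close>.
\<close>

definition contraction :: "('a::metric_space \<Rightarrow> 'a) \<Rightarrow> bool" where
  "contraction f \<longleftrightarrow> (\<exists>L<1. L-lipschitz_on UNIV f)"

definition iterated_function_system :: "('a::complete_space \<Rightarrow> 'a) set \<Rightarrow> bool" where
  "iterated_function_system F \<longleftrightarrow> finite F \<and> F \<noteq> {} \<and> (\<forall>f\<in>F. contraction f)"

text \<open>The identity map belongs to the generated semigroup only if it is itself a nonempty
  composition of generators.\<close>

inductive_set semigroup_gen :: "('a \<Rightarrow> 'a) set \<Rightarrow> ('a \<Rightarrow> 'a) set"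
  for F :: "('a \<Rightarrow> 'a) set" where
  base: "f \<in> F \<Longrightarrow> f \<in> semigroup_gen F"
| comp: "s \<in> semigroup_gen F \<Longrightarrow> t \<in> semigroup_gen F \<Longrightarrow> s \<circ> t \<in> semigroup_gen F"

text \<open>The Cayley graph has one arc for each pair \<open>(s, f)\<close>; loops and parallel arcs are allowed.\<close>

definition cayley_graph ::
    "('a \<Rightarrow> 'a) set \<Rightarrow> ('a \<Rightarrow> 'a, ('a \<Rightarrow> 'a) \<times> ('a \<Rightarrow> 'a)) pre_digraph" where
  "cayley_graph F =
     \<lparr>verts = semigroup_gen F, arcs = semigroup_gen F \<times> F,
      tail = fst, head = (\<lambda>(s, f). s \<circ> f)\<rparr>"

definition dead_end :: "('v, 'e) pre_digraph \<Rightarrow> 'v \<Rightarrow> bool" where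
  "dead_end G v \<longleftrightarrow> v \<in> verts G \<and> (\<forall>e\<in>out_arcs G v. head G e = tail G e)"

lemma wf_digraph_cayley_graph: "wf_digraph (cayley_graph F)"
  by unfold_locales (auto simp: cayley_graph_def intro: semigroup_gen.intros)

lemma dead_end_cayley_graph_iff:
  "dead_end (cayley_graph F) U \<longleftrightarrow> U \<in> semigroup_gen F \<and> (\<forall>f\<in>F. U \<circ> f = U)"
  by (auto simp: dead_end_def cayley_graph_def out_arcs_def)

end

theory Submission
  imports Defs
begin

text \<open>The only substantial step is that \<open>U \<circ> V = U\<close> forces \<open>U\<close> to be constant: then
  \<open>U = U \<circ> V\<^sup>n\<close> for every \<open>n\<close>, so the Lipschitz constants of \<open>U\<close> can be chosen to tend to \<open>0\<close>.\<close>

lemma contraction_compose: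
  assumes "contraction f" "contraction g"
  shows "contraction (f \<circ> g)"
proof -
  obtain K L where f: "K < 1" "K-lipschitz_on UNIV f" and g: "L < 1" "L-lipschitz_on UNIV g"
    using assms unfolding contraction_def by blast
  have "(K * L)-lipschitz_on UNIV (f \<circ> g)"
    using f g by (intro lipschitz_on_compose) (auto intro: lipschitz_on_subset)
  \<comment> \<open>Upper bounds alone do not suffice, since two large negative numbers have a large
    product; nonnegativity of Lipschitz constants excludes this.\<close>
  moreover have "K * L < 1"
    using f(1) g(1) lipschitz_on_nonneg[OF f(2)] lipschitz_on_nonneg[OF g(2)]
    by (metis less_eq_real_def mult_le_one mult_left_le order.strict_trans1)
  ultimately show ?thesis
    unfolding contraction_def by blast
qed

lemma contraction_semigroup_gen:
  assumes "\<forall>f\<in>F. contraction f" "s \<in> semigroup_gen F"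
  shows "contraction s"
  using assms(2) by induction (use assms(1) contraction_compose in blast)+

lemma lipschitz_fixed_by_contraction_imp_constant:
  fixes U :: "'a::metric_space \<Rightarrow> 'b::metric_space"
  assumes U: "L-lipschitz_on UNIV U" and V: "contraction V" and fixed: "U \<circ> V = U"
  shows "U constant_on UNIV"
proof -
  obtain K where K: "K < 1" "K-lipschitz_on UNIV V"
    using V unfolding contraction_def by blast
  \<comment> \<open>Precomposing with \<open>V\<close> gains a factor \<open>K\<close> in the
    constant, while \<open>fixed\<close> returns the same map \<open>U\<close>.\<close>
  have lip: "(L * K ^ n)-lipschitz_on UNIV U" for n
  proof (induction n)
    case 0
    then show ?case using U by simp
  next
    case (Suc n)
    then have "(L * K ^ n * K)-lipschitz_on UNIV (U \<circ> V)"
      using K(2) by (intro lipschitz_on_compose) (auto intro: lipschitz_on_subset)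
    then show ?case
      by (simp add: fixed mult_ac)
  qed
  have "U x = U y" for x y
  proof -
    \<comment> \<open>Nonnegativity of \<open>K\<close> turns \<open>K < 1\<close> into a bound on
      its absolute value.\<close>
    have "(\<lambda>n. K ^ n) \<longlonglongrightarrow> 0"
      using K(1) lipschitz_on_nonneg[OF K(2)] by (intro LIMSEQ_power_zero) auto
    then have "(\<lambda>n. L * K ^ n * dist x y) \<longlonglongrightarrow> 0"
      by (intro tendsto_mult_left_zero tendsto_mult_right_zero)
    moreover have "dist (U x) (U y) \<le> L * K ^ n * dist x y" for n
      using lipschitz_onD[OF lip] by simp
    ultimately have "dist (U x) (U y) \<le> 0"
      by (intro LIMSEQ_le_const) auto
    then show ?thesis by simp
  qed
  then show ?thesis
    unfolding constant_on_def by blast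
qed

theorem lemma9:
  fixes F :: "('a::complete_space \<Rightarrow> 'a) set" and U :: "'a \<Rightarrow> 'a"
  assumes "iterated_function_system F"
    and "U \<in> semigroup_gen F"
  shows "(U constant_on UNIV \<longleftrightarrow> (\<exists>V\<in>semigroup_gen F. U \<circ> V = U))
    \<and> (U constant_on UNIV \<longleftrightarrow> U \<circ> U = U)
    \<and> (U constant_on UNIV \<longleftrightarrow> dead_end (cayley_graph F) U)"
proof -
  have contr: "contraction s" if "s \<in> semigroup_gen F" for s
    using assms(1) that contraction_semigroup_gen
    unfolding iterated_function_system_def by blast
  have const: "U constant_on UNIV" if "V \<in> semigroup_gen F" "U \<circ> V = U" for V
    using contr[OF assms(2)] contr[OF that(1)] that(2)
      lipschitz_fixed_by_contraction_imp_constant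
    unfolding contraction_def[of U] by blast
  \<comment> \<open>With \<open>g\<close> arbitrary, this serves both \<open>g = U\<close> and every
    generator.\<close>
  have absorbs: "U \<circ> g = U" if "U constant_on UNIV" for g
    using that unfolding constant_on_def by fastforce
  \<comment> \<open>For empty \<open>F\<close> the dead-end condition on arcs would be vacuous; a
    generator supplies the \<open>V\<close> for \<open>const\<close>.\<close>
  obtain f where "f \<in> F"
    using assms(1) unfolding iterated_function_system_def by blast
  then have "U constant_on UNIV" if "dead_end (cayley_graph F) U"
    using that const semigroup_gen.base unfolding dead_end_cayley_graph_iff by blast
  moreover have "dead_end (cayley_graph F) U" if "U constant_on UNIV"
    using absorbs[OF that] assms(2) unfolding dead_end_cayley_graph_iff by blast
  \<comment> \<open>Taking \<open>V = U\<close> in \<open>const\<close> handles idempotence;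
    conversely, \<open>absorbs\<close> makes \<open>U\<close> itself the witness
    \<open>V\<close>.\<close>
  ultimately show ?thesis
    using const absorbs assms(2) by blast
qed

end
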